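(* Let $b,c\in\mathbb{R}$ be not simultaneously zero. The real four-dimensional solvable Lie algebra with generators (linear basis) $p,q,H,E$, where $E$ is central, and commutation relations $$[p,q]=H,\qquad [q,H]=c\,E,\qquad [H,p]=b\,E,$$ can be identified with (i.e. is isomorphic, as a real Lie algebra, to) the Lie algebra $\eta_4$.
   Context: $\eta_4$ is the real four-dimensional Lie algebra with linear basis $e_1,e_2,e_3,e_4$ whose only non-zero commutation relations among basis elements are (up to antisymmetry) $[e_4,e_1]=e_2$ and $[e_4,e_2]=e_3$; it is one of the fifteen isomorphism classes in the classification list of real four-dimensional solvable Lie algebras. The algebra generated by $p,q,H,E$ is the real form of the centrally extended Heisenberg algebra $CEHeis$ with parameter $z$, where $c=\mathrm{Re}\,z/2$ and $b=\mathrm{Im}\,z/2$. *)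

theory Defs
  imports "HOL-Analysis.Analysis"
begin

definition lie_algebra :: "('a::real_vector \<Rightarrow> 'a \<Rightarrow> 'a) \<Rightarrow> bool" where
  "lie_algebra br \<longleftrightarrow>
     bilinear br \<and>
     (\<forall>x. br x x = 0) \<and>
     (\<forall>x y z. br x (br y z) + br y (br z x) + br z (br x y) = 0)"

definition lie_isomorphic ::
  "('a::real_vector \<Rightarrow> 'a \<Rightarrow> 'a) \<Rightarrow> ('b::real_vector \<Rightarrow> 'b \<Rightarrow> 'b) \<Rightarrow> bool" where
  "lie_isomorphic br br' \<longleftrightarrow>
     (\<exists>f. linear f \<and> bij f \<and> (\<forall>x y. f (br x y) = br' (f x) (f y)))"

primrec derived_series :: "('a::real_vector \<Rightarrow> 'a \<Rightarrow> 'a) \<Rightarrow> nat \<Rightarrow> 'a set" where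
  "derived_series br 0 = UNIV"
| "derived_series br (Suc n) =
     span {br x y | x y. x \<in> derived_series br n \<and> y \<in> derived_series br n}"

definition lie_solvable :: "('a::real_vector \<Rightarrow> 'a \<Rightarrow> 'a) \<Rightarrow> bool" where
  "lie_solvable br \<longleftrightarrow> (\<exists>n. derived_series br n = {0})"

definition linear_basis :: "'a::real_vector list \<Rightarrow> bool" where
  "linear_basis bs \<longleftrightarrow> distinct bs \<and> independent (set bs) \<and> span (set bs) = UNIV"

definition ceheis_real ::
  "real \<Rightarrow> real \<Rightarrow> ('a::real_vector \<Rightarrow> 'a \<Rightarrow> 'a) \<Rightarrow> 'a \<Rightarrow> 'a \<Rightarrow> 'a \<Rightarrow> 'a \<Rightarrow> bool" where
  "ceheis_real b c br p q H E \<longleftrightarrow>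
     lie_algebra br \<and> linear_basis [p, q, H, E] \<and>
     (\<forall>x. br E x = 0) \<and>
     br p q = H \<and> br q H = c *\<^sub>R E \<and> br H p = b *\<^sub>R E"

definition eta4 ::
  "('a::real_vector \<Rightarrow> 'a \<Rightarrow> 'a) \<Rightarrow> 'a \<Rightarrow> 'a \<Rightarrow> 'a \<Rightarrow> 'a \<Rightarrow> bool" where
  "eta4 br e1 e2 e3 e4 \<longleftrightarrow>
     lie_algebra br \<and> linear_basis [e1, e2, e3, e4] \<and>
     br e4 e1 = e2 \<and> br e4 e2 = e3 \<and> br e4 e3 = 0 \<and>
     br e1 e2 = 0 \<and> br e1 e3 = 0 \<and> br e2 e3 = 0"

text \<open>The two predicates prescribe the bracket on a basis, hence determine the algebra up to
  isomorphism. The following models show that both presentations are realised, so that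
  the Jacobi identity and the linear independence of the generators impose no restriction on
  the structure constants.\<close>

lemma linear_basis_axes:
  "linear_basis [axis 1 1, axis 2 1, axis 3 1, axis 4 1 :: real ^ 4]"
proof -
  have "set [axis 1 1, axis 2 1, axis 3 1, axis 4 1 :: real ^ 4] = Basis"
    by (auto simp: Basis_vec_def) (metis exhaust_4)
  then show ?thesis
    unfolding linear_basis_def
    by (simp only: independent_Basis span_Basis) (simp add: axis_eq_axis)
qed

lemma ceheis_real_exists:
  "\<exists>(br :: real ^ 4 \<Rightarrow> real ^ 4 \<Rightarrow> real ^ 4) p q H E. ceheis_real b c br p q H E"
proof -
  let ?br = "\<lambda>x y :: real ^ 4. (x$1 * y$2 - x$2 * y$1) *\<^sub>R axis 3 (1::real)
      + (c * (x$2 * y$3 - x$3 * y$2) + b * (x$3 * y$1 - x$1 * y$3)) *\<^sub>R axis 4 1"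
  have "lie_algebra ?br"
    unfolding lie_algebra_def bilinear_def
    by (auto simp: vec_eq_iff forall_4 axis_def algebra_simps intro!: linearI)
  then have "ceheis_real b c ?br (axis 1 1) (axis 2 1) (axis 3 1) (axis 4 1)"
    unfolding ceheis_real_def using linear_basis_axes
    by (simp add: vec_eq_iff forall_4) (simp add: axis_def)
  then show ?thesis by blast
qed

lemma eta4_exists:
  "\<exists>(br :: real ^ 4 \<Rightarrow> real ^ 4 \<Rightarrow> real ^ 4) e1 e2 e3 e4. eta4 br e1 e2 e3 e4"
proof -
  let ?br = "\<lambda>x y :: real ^ 4. (x$4 * y$1 - x$1 * y$4) *\<^sub>R axis 2 (1::real)
      + (x$4 * y$2 - x$2 * y$4) *\<^sub>R axis 3 1"
  have "lie_algebra ?br"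
    unfolding lie_algebra_def bilinear_def
    by (auto simp: vec_eq_iff forall_4 axis_def algebra_simps intro!: linearI)
  then have "eta4 ?br (axis 1 1) (axis 2 1) (axis 3 1) (axis 4 1)"
    unfolding eta4_def using linear_basis_axes
    by (simp add: vec_eq_iff forall_4) (simp add: axis_def)
  then show ?thesis by blast
qed

end

theory Submission
  imports Defs
begin

text \<open>Put r = b^2 + c^2 > 0. The element e1 = c p + b q commutes with H, and e4 = b p - c q
  satisfies [e4, e1] = r H and [e4, r H] = - r^2 E. So e1, e2 = r H, e3 = - r^2 E and e4
  satisfy the relations of eta4, and they span because p and q can be solved for.\<close>

section \<open>Lists of basis vectors and linear maps between them\<close>

text \<open>By the Steinitz bound, no finite spanning set has fewer than \<open>length bs\<close>
  elements, but a repeated or redundant entry of \<open>cs\<close> would produce one. A change of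
  basis thus only has to be checked for spanning.\<close>

lemma linear_basis_spanning:
  fixes bs cs :: "'a::real_vector list"
  assumes "linear_basis bs" and "span (set cs) = UNIV" and "length cs = length bs"
  shows "linear_basis cs"
proof -
  have bs: "distinct bs" "independent (set bs)"
    using assms(1) by (auto simp: linear_basis_def)
  have bound: "length bs \<le> card T" if "finite T" "span T = UNIV" for T :: "'a set"
    using independent_span_bound[OF that(1) bs(2)] that(2) distinct_card[OF bs(1)] by simp
  have "distinct cs"
    using bound[of "set cs"] assms(2,3) card_length[of cs] by (simp add: card_distinct)
  moreover have "independent (set cs)"
  proof
    assume "dependent (set cs)"
    then obtain a where a: "a \<in> set cs" "a \<in> span (set cs - {a})"
      by (auto simp: dependent_def)
    then have "span (set cs - {a}) = UNIV"
      using assms(2) span_redundant[OF a(2)] by (simp add: insert_absorb)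
    then have "length bs \<le> card (set cs - {a})"
      by (intro bound) auto
    moreover have "card (set cs - {a}) < card (set cs)"
      using a(1) by (intro card_Diff1_less) auto
    ultimately show False
      using card_length[of cs] assms(3) by simp
  qed
  ultimately show ?thesis
    using assms(2) by (simp add: linear_basis_def)
qed

lemma linear_basis_extend:
  assumes "linear_basis bs" and "length cs = length bs"
  obtains f where "linear f" and "map f bs = cs"
proof -
  \<comment> \<open>\<open>map_of (zip bs cs)\<close> matches the lists entry by entry, which is
    consistent because \<open>bs\<close> is distinct; only its values on \<open>set bs\<close>
    matter.\<close>
  obtain f where "linear f" and f: "\<forall>x\<in>set bs. f x = the (map_of (zip bs cs) x)"
    using linear_independent_extend[of "set bs" "\<lambda>x. the (map_of (zip bs cs) x)"] assms(1)
    by (auto simp: linear_basis_def)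
  moreover have "map f bs = cs"
  proof (rule nth_equalityI)
    fix i assume "i < length (map f bs)"
    then show "map f bs ! i = cs ! i"
      using f assms by (simp add: linear_basis_def map_of_zip_nth)
  qed (simp add: assms)
  ultimately show thesis
    using that by blast
qed

text \<open>The linear extensions of \<open>bs\<close> to \<open>cs\<close> and of \<open>cs\<close>
  to \<open>bs\<close> are mutually inverse, since each composite fixes a basis.\<close>

lemma linear_basis_bij:
  assumes "linear_basis bs" and "linear_basis cs" and "length cs = length bs"
  obtains f where "linear f" and "bij f" and "map f bs = cs"
proof -
  \<comment> \<open>The type \<open>'c\<close> stays generic: the fact is used on both spaces, for
    \<open>g \<circ> f\<close> and for \<open>f \<circ> g\<close>.\<close>
  have id: "k = id" if "linear k" "map k ds = ds" "linear_basis ds"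
    for k :: "'c::real_vector \<Rightarrow> 'c" and ds
  proof
    fix x
    have "x \<in> span (set ds)"
      using that(3) by (simp add: linear_basis_def)
    moreover have "k y = id y" if "y \<in> set ds" for y
      using \<open>map k ds = ds\<close> that by (metis id_apply map_eq_conv list.map_id0)
    ultimately show "k x = id x"
      using linear_eq_on[OF that(1) linear_id] by blast
  qed
  obtain f where f: "linear f" "map f bs = cs"
    using linear_basis_extend[OF assms(1,3)] .
  obtain g where g: "linear g" "map g cs = bs"
    using linear_basis_extend[OF assms(2)] assms(3) by metis
  have "g \<circ> f = id"
    using f g assms by (intro id[of _ bs] linear_compose) (simp_all flip: map_map)
  moreover have "f \<circ> g = id"
    using f g assms by (intro id[of _ cs] linear_compose) (simp_all flip: map_map)
  ultimately show thesis
    using that[OF f(1) _ f(2)] o_bij by blast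
qed

section \<open>Consequences of bilinearity of the bracket\<close>

lemma lie_algebra_flip:
  assumes "lie_algebra br" shows "br x y = - br y x"
proof -
  have bil: "bilinear br" and alt: "\<And>x. br x x = 0"
    using assms by (auto simp: lie_algebra_def)
  have "br x y + br y x = 0"
    using alt[of "x + y", unfolded bilinear_ladd[OF bil] bilinear_radd[OF bil]]
    by (simp add: alt add.commute)
  then show ?thesis
    by (simp only: eq_neg_iff_add_eq_0)
qed

text \<open>Induction over one span and then the other. This reduces bounds on the derived series to
  brackets of generators.\<close>

lemma bilinear_mem_span:
  assumes "bilinear h" and "x \<in> span S" and "y \<in> span T"
    and "\<And>u v. u \<in> S \<Longrightarrow> v \<in> T \<Longrightarrow> h u v \<in> span U"
  shows "h x y \<in> span U"
proof -
  have "h u y \<in> span U" if "u \<in> S" for u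
    using assms(3)
    by (induction rule: span_induct_alt)
       (auto simp: bilinear_rzero[OF assms(1)] bilinear_radd[OF assms(1)]
         bilinear_rmul[OF assms(1)] intro!: span_add span_scale assms(4) that span_zero)
  with assms(2) show ?thesis
    by (induction rule: span_induct_alt)
       (auto simp: bilinear_lzero[OF assms(1)] bilinear_ladd[OF assms(1)]
         bilinear_lmul[OF assms(1)] intro!: span_add span_scale span_zero)
qed

section \<open>The algebra eta4: multiplication table, solvability, uniqueness\<close>

lemma eta4_brackets:
  assumes "eta4 br e1 e2 e3 e4"
  shows "br e1 e1 = 0" "br e1 e2 = 0" "br e1 e3 = 0" "br e1 e4 = - e2"
    "br e2 e1 = 0" "br e2 e2 = 0" "br e2 e3 = 0" "br e2 e4 = - e3"
    "br e3 e1 = 0" "br e3 e2 = 0" "br e3 e3 = 0" "br e3 e4 = 0"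
    "br e4 e1 = e2" "br e4 e2 = e3" "br e4 e3 = 0" "br e4 e4 = 0"
proof -
  have lie: "lie_algebra br"
    using assms by (simp add: eta4_def)
  then have alt: "br x x = 0" for x
    by (simp add: lie_algebra_def)
  have rel: "br e4 e1 = e2" "br e4 e2 = e3" "br e4 e3 = 0" "br e1 e2 = 0" "br e1 e3 = 0"
    "br e2 e3 = 0"
    using assms by (auto simp only: eta4_def)
  \<comment> \<open>Only instances leading to a prescribed bracket are listed; as a rewrite rule the
    general identity would loop.\<close>
  note flip = lie_algebra_flip[OF lie, of e1 e4] lie_algebra_flip[OF lie, of e2 e4]
    lie_algebra_flip[OF lie, of e3 e4] lie_algebra_flip[OF lie, of e2 e1]
    lie_algebra_flip[OF lie, of e3 e1] lie_algebra_flip[OF lie, of e3 e2]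
  show "br e1 e1 = 0" "br e1 e2 = 0" "br e1 e3 = 0" "br e1 e4 = - e2"
    "br e2 e1 = 0" "br e2 e2 = 0" "br e2 e3 = 0" "br e2 e4 = - e3"
    "br e3 e1 = 0" "br e3 e2 = 0" "br e3 e3 = 0" "br e3 e4 = 0"
    "br e4 e1 = e2" "br e4 e2 = e3" "br e4 e3 = 0" "br e4 e4 = 0"
    using rel by (simp_all add: alt flip)
qed

text \<open>All brackets lie in the span of \<open>e2\<close> and \<open>e3\<close>, which is
  abelian, so the series vanishes at its second step.\<close>

lemma eta4_solvable:
  assumes "eta4 br e1 e2 e3 e4"
  shows "lie_solvable br"
proof -
  have bil: "bilinear br" and sp: "span {e1, e2, e3, e4} = UNIV"
    using assms by (auto simp: eta4_def lie_algebra_def linear_basis_def)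
  note br = eta4_brackets[OF assms]
  have "br x y \<in> span {e2, e3}" for x y
    by (rule bilinear_mem_span[OF bil, where S="{e1, e2, e3, e4}" and T="{e1, e2, e3, e4}"])
       (auto simp: sp br span_base span_neg span_zero)
  then have D1: "derived_series br 1 \<subseteq> span {e2, e3}"
    unfolding One_nat_def derived_series.simps by (intro span_minimal) auto
  have "br x y \<in> span {}" if "x \<in> span {e2, e3}" "y \<in> span {e2, e3}" for x y
    by (rule bilinear_mem_span[OF bil that]) (auto simp: br)
  then have "derived_series br (Suc 1) \<subseteq> span {}"
    using D1 unfolding derived_series.simps(2)[of br 1] by (intro span_minimal) auto
  then have "derived_series br 2 = {0}"
    using span_zero by (auto simp: numeral_2_eq_2)
  then show ?thesis
    unfolding lie_solvable_def by blast
qed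

text \<open>Match the two bases by a linear bijection. Both sides of the homomorphism law are
  bilinear, so comparing the two multiplication tables is enough.\<close>

lemma eta4_unique:
  assumes "eta4 br e1 e2 e3 e4" and "eta4 br' e1' e2' e3' e4'"
  shows "lie_isomorphic br br'"
proof -
  have bil: "bilinear br" and basis: "linear_basis [e1, e2, e3, e4]"
    using assms(1) by (auto simp: eta4_def lie_algebra_def)
  have bil': "bilinear br'" and basis': "linear_basis [e1', e2', e3', e4']"
    using assms(2) by (auto simp: eta4_def lie_algebra_def)
  obtain f where f: "linear f" "bij f" and "map f [e1, e2, e3, e4] = [e1', e2', e3', e4']"
    using linear_basis_bij[OF basis basis'] by auto
  then have fe: "f e1 = e1'" "f e2 = e2'" "f e3 = e3'" "f e4 = e4'"
    by auto
  have bils: "bilinear (\<lambda>x y. f (br x y))" "bilinear (\<lambda>x y. br' (f x) (f y))"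
    using bil bil' f(1)
    by (auto simp: bilinear_def linear_iff)
  have sp: "span {e1, e2, e3, e4} = UNIV"
    using basis by (simp add: linear_basis_def)
  have "f (br x y) = br' (f x) (f y)" for x y
    by (rule bilinear_eq[OF bils equalityD2[OF sp] equalityD2[OF sp]])
       (auto simp: fe eta4_brackets[OF assms(1)] eta4_brackets[OF assms(2)]
         linear_neg[OF f(1)] linear_0[OF f(1)])
  with f show ?thesis
    unfolding lie_isomorphic_def by blast
qed

section \<open>The change of basis to eta4\<close>

lemma ceheis_real_eta4:
  fixes b c :: real
  assumes "\<not> (b = 0 \<and> c = 0)" and "ceheis_real b c br p q H E"
  defines "r \<equiv> b\<^sup>2 + c\<^sup>2"
  shows "eta4 br (c *\<^sub>R p + b *\<^sub>R q) (r *\<^sub>R H) (- r\<^sup>2 *\<^sub>R E) (b *\<^sub>R p - c *\<^sub>R q)"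
    (is "eta4 br ?e1 ?e2 ?e3 ?e4")
proof -
  have lie: "lie_algebra br" and basis: "linear_basis [p, q, H, E]"
    and E: "\<And>x. br E x = 0" and rel: "br p q = H" "br q H = c *\<^sub>R E" "br H p = b *\<^sub>R E"
    using assms(2) by (auto simp: ceheis_real_def)
  have bil: "bilinear br" and alt: "\<And>x. br x x = 0"
    using lie by (auto simp: lie_algebra_def)
  have rel': "br q p = - H" "br H q = - (c *\<^sub>R E)" "br p H = - (b *\<^sub>R E)" "br x E = 0" for x
    using rel E lie_algebra_flip[OF lie] by (metis, metis, metis, metis neg_0_equal_iff_equal)
  note expand = bilinear_ladd[OF bil] bilinear_radd[OF bil] bilinear_lsub[OF bil]
    bilinear_rsub[OF bil] bilinear_lmul[OF bil] bilinear_rmul[OF bil]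
    bilinear_lneg[OF bil] bilinear_rneg[OF bil]
  have r: "r \<noteq> 0"
    using assms(1) by (simp add: r_def sum_power2_eq_zero_iff)
  let ?S = "span (set [?e1, ?e2, ?e3, ?e4])"
  \<comment> \<open>The matrix taking \<open>p\<close>, \<open>q\<close> to \<open>?e1\<close>,
    \<open>?e4\<close> has rows (c, b) and (b, -c). Its square is r times the identity, so its
    inverse is itself divided by r.\<close>
  have p: "p = (c / r) *\<^sub>R ?e1 + (b / r) *\<^sub>R ?e4" and q: "q = (b / r) *\<^sub>R ?e1 - (c / r) *\<^sub>R ?e4"
  proof -
    have one: "(c * c + b * b) / r = 1"
      using r by (simp add: r_def power2_eq_square add.commute)
    have "(c / r) *\<^sub>R ?e1 + (b / r) *\<^sub>R ?e4 = ((c * c + b * b) / r) *\<^sub>R p"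
      by (simp add: algebra_simps add_divide_distrib)
    then show "p = (c / r) *\<^sub>R ?e1 + (b / r) *\<^sub>R ?e4"
      by (simp only: one scaleR_one)
    have "(b / r) *\<^sub>R ?e1 - (c / r) *\<^sub>R ?e4 = ((c * c + b * b) / r) *\<^sub>R q"
      by (simp add: algebra_simps add_divide_distrib)
    then show "q = (b / r) *\<^sub>R ?e1 - (c / r) *\<^sub>R ?e4"
      by (simp only: one scaleR_one)
  qed
  have "p \<in> ?S"
    by (subst p, intro span_add span_scale span_base) auto
  moreover have "q \<in> ?S"
    by (subst q, intro span_diff span_scale span_base) auto
  \<comment> \<open>Once the nonzero \<open>r\<close> cancels, these multiples are \<open>H\<close>
    and \<open>E\<close>.\<close>
  moreover have "(1 / r) *\<^sub>R ?e2 \<in> ?S" "(- 1 / r\<^sup>2) *\<^sub>R ?e3 \<in> ?S"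
    by (intro span_scale span_base; simp)+
  ultimately have "set [p, q, H, E] \<subseteq> ?S"
    using r by simp
  then have "span (set [p, q, H, E]) \<subseteq> ?S"
    by (rule span_minimal) simp
  then have "linear_basis [?e1, ?e2, ?e3, ?e4]"
    using basis by (intro linear_basis_spanning[OF basis]) (auto simp: linear_basis_def)
  moreover have "br ?e4 ?e1 = ?e2"
    by (simp add: expand rel rel' alt r_def power2_eq_square algebra_simps)
  moreover have "br ?e4 ?e2 = ?e3"
  proof -
    \<comment> \<open>One factor \<open>r\<close> is the coefficient of \<open>H\<close> and stays
      folded; the other emerges from the bracket as b * b + c * c.\<close>
    have "br ?e4 ?e2 = - (r * (b * b + c * c)) *\<^sub>R E"
      by (simp add: expand rel rel' algebra_simps)
    then show ?thesis
      by (simp add: r_def power2_eq_square)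
  qed
  moreover have "br ?e4 ?e3 = 0" "br ?e1 ?e2 = 0" "br ?e1 ?e3 = 0" "br ?e2 ?e3 = 0"
    by (simp_all add: expand rel rel' algebra_simps)
  ultimately show ?thesis
    using lie by (simp add: eta4_def)
qed

theorem corollary1:
  fixes b c :: real
    and br :: "'a::real_vector \<Rightarrow> 'a \<Rightarrow> 'a" and p q H E :: 'a
    and br' :: "'b::real_vector \<Rightarrow> 'b \<Rightarrow> 'b" and e1 e2 e3 e4 :: 'b
  assumes "\<not> (b = 0 \<and> c = 0)"
    and "ceheis_real b c br p q H E"
    and "eta4 br' e1 e2 e3 e4"
  shows "lie_solvable br \<and> lie_isomorphic br br'"
  \<comment> \<open>In the new basis \<open>br\<close> itself satisfies \<open>eta4\<close>, so
    solvability applies to it directly and the isomorphism is the uniqueness of eta4.\<close>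
  using ceheis_real_eta4[OF assms(1,2)] assms(3) eta4_solvable eta4_unique by blast

end
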